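(* Let $q=3^h$ with $h\ge2$, and put $$S_q=\frac{q(\sqrt2-1)}{q(2-\sqrt2)-1},\qquad c_+=\frac{2+\sqrt2}{4}.$$ Let $\phi\in\mathcal T_q^0$ with zero-sum parameter $c=\cos^2\theta$ (both defined in the context). If $$\sigma_{\min}(\mathcal M_\phi)\ge(1-\varepsilon)S_q,\qquad 0\le\varepsilon<\frac{\sqrt2}{2(q-1)},$$ then $$|c-c_+|\le\frac{\varepsilon}{\sqrt2}.$$
   Context: $G_q=\mathbb F_q\rtimes\mathbb F_q^\times$ is the affine group with product $(k,l)(k',l')=(k+lk',ll')$, acting on $\mathbb C^{\mathbb F_q^\times}$ by the unitary representation $(\pi_q(k,l)f)(m)=\psi_0(km)f(lm)$, where $\psi_0$ is any fixed nontrivial additive character of $\mathbb F_q$. For a vector $\phi$, $\mathcal M_\phi:\mathbb C^{\mathbb F_q^\times\times\mathbb F_q^\times}\to\mathbb C^{G_q}$ is the linear map $\mathcal M_\phi(A)(g)=\langle A\pi_q(g)\phi,\pi_q(g)\phi\rangle$, and $\sigma_{\min}(\mathcal M_\phi)=\min_{A\ne0}\|\mathcal M_\phi(A)\|_{\ell^2(G_q)}/\|A\|_F$ (Frobenius norm; counting measure on $G_q$). $\mathcal T_q^0$ is the family of real unit vectors $\phi\in\mathbb R^{\mathbb F_q^\times}$ of the form $\phi(m)=u_{\tau(m)}$ with $u_0+u_1+u_2=0$, where $\tau=\operatorname{Tr}_{\mathbb F_q/\mathbb F_3}$. For $\phi\in\mathcal T_q^0$, the three values are, up to a positive scalar (normalization),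 $F(j)=\gamma\zeta^j+\overline\gamma\zeta^{-j}$, $j\in\mathbb F_3$, where $\zeta=e^{2\pi i/3}$ and $\gamma=\rho e^{i\theta}\ne0$ with $\rho>0$; the zero-sum parameter of $\phi$ is $c=\cos^2\theta$. *)

theory Defs
  imports "HOL-Analysis.Analysis" "HOL-Algebra.Group"
begin

text \<open>
  The field \<open>F\<^sub>q\<close> is a type \<open>'a\<close> of class \<open>{finite, field}\<close>. Vectors indexed by the
  nonzero elements are functions on all of \<open>'a\<close> whose value at 0 is never used; likewise for
  matrices.
\<close>

abbreviation nonzero :: "'a::{finite,field} set" where
  "nonzero \<equiv> UNIV - {0}"

definition affine_group :: "('a::{finite,field} \<times> 'a) monoid" where
  "affine_group =
     \<lparr>carrier = UNIV \<times> nonzero,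
      monoid.mult = (\<lambda>(k, l) (k', l'). (k + l * k', l * l')),
      one = (0, 1)\<rparr>"

definition nontrivial_additive_character :: "('a::{finite,field} \<Rightarrow> complex) \<Rightarrow> bool" where
  "nontrivial_additive_character \<psi> \<longleftrightarrow>
     (\<forall>x y. \<psi> (x + y) = \<psi> x * \<psi> y) \<and> (\<forall>x. cmod (\<psi> x) = 1) \<and> (\<exists>x. \<psi> x \<noteq> 1)"

definition affine_rep ::
    "('a::{finite,field} \<Rightarrow> complex) \<Rightarrow> 'a \<times> 'a \<Rightarrow> ('a \<Rightarrow> complex) \<Rightarrow> 'a \<Rightarrow> complex" where
  "affine_rep \<psi> g f = (\<lambda>m. \<psi> (fst g * m) * f (snd g * m))"

definition cinner_nz :: "('a::{finite,field} \<Rightarrow> complex) \<Rightarrow> ('a \<Rightarrow> complex) \<Rightarrow> complex" where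
  "cinner_nz v w = (\<Sum>m\<in>nonzero. v m * cnj (w m))"

definition mat_vec_nz ::
    "('a::{finite,field} \<Rightarrow> 'a \<Rightarrow> complex) \<Rightarrow> ('a \<Rightarrow> complex) \<Rightarrow> 'a \<Rightarrow> complex" where
  "mat_vec_nz A v = (\<lambda>m. \<Sum>n\<in>nonzero. A m n * v n)"

definition meas_map ::
    "('a::{finite,field} \<Rightarrow> complex) \<Rightarrow> ('a \<Rightarrow> complex) \<Rightarrow> ('a \<Rightarrow> 'a \<Rightarrow> complex) \<Rightarrow> 'a \<times> 'a \<Rightarrow> complex" where
  "meas_map \<psi> \<phi> A g =
     cinner_nz (mat_vec_nz A (affine_rep \<psi> g \<phi>)) (affine_rep \<psi> g \<phi>)"

definition frobenius_norm_nz :: "('a::{finite,field} \<Rightarrow> 'a \<Rightarrow> complex) \<Rightarrow> real" where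
  "frobenius_norm_nz A = L2_set (\<lambda>(m, n). cmod (A m n)) (nonzero \<times> nonzero)"

text \<open>
  The infimum is over the matrices that are nonzero as matrices on the nonzero field elements;
  it is attained, the matrix space being finite-dimensional.
\<close>

definition sigma_min :: "('a::{finite,field} \<Rightarrow> complex) \<Rightarrow> ('a \<Rightarrow> complex) \<Rightarrow> real" where
  "sigma_min \<psi> \<phi> =
     (INF A \<in> {A. \<exists>m\<in>nonzero. \<exists>n\<in>nonzero. A m n \<noteq> 0}.
        L2_set (\<lambda>g. cmod (meas_map \<psi> \<phi> A g)) (carrier affine_group) / frobenius_norm_nz A)"

text \<open>
  The trace to \<open>F\<^sub>3\<close> of a field with \<open>3 ^ h\<close> elements, as the sum of the Galois conjugates. Its
  values lie in the prime subfield \<open>{0, 1, 2}\<close> of \<open>'a\<close>.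
\<close>

definition trace3 :: "nat \<Rightarrow> 'a::{finite,field} \<Rightarrow> 'a" where
  "trace3 h x = (\<Sum>i<h. x ^ (3 ^ i))"

definition zero_sum_family :: "nat \<Rightarrow> ('a::{finite,field} \<Rightarrow> real) set" where
  "zero_sum_family h =
     {\<phi>. L2_set \<phi> nonzero = 1 \<and>
         (\<exists>u :: 'a \<Rightarrow> real. u 0 + u 1 + u 2 = 0 \<and> (\<forall>m\<in>nonzero. \<phi> m = u (trace3 h m)))}"

text \<open>
  An element \<open>j\<close> of \<open>F\<^sub>3\<close> is represented by any integer lift: the value below depends only
  on \<open>j\<close> modulo 3.
\<close>

definition zero_sum_profile :: "complex \<Rightarrow> int \<Rightarrow> complex" where
  "zero_sum_profile \<gamma> j =
     \<gamma> * cis (2 * pi / 3) powi j + cnj \<gamma> * cis (2 * pi / 3) powi (- j)"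

text \<open>
  The positive scalar \<open>s\<close> is the normalization. For \<open>\<phi>\<close> in \<open>zero_sum_family h\<close> on a field with
  \<open>3 ^ h\<close> elements, \<open>h \<ge> 2\<close>, exactly one \<open>c\<close> satisfies this relation.
\<close>

definition has_zero_sum_parameter :: "nat \<Rightarrow> ('a::{finite,field} \<Rightarrow> real) \<Rightarrow> real \<Rightarrow> bool" where
  "has_zero_sum_parameter h \<phi> c \<longleftrightarrow>
     (\<exists>s \<rho> \<theta>. s > 0 \<and> \<rho> > 0 \<and>
        (\<forall>m\<in>nonzero. \<forall>j. trace3 h m = of_int j \<longrightarrow>
           complex_of_real (\<phi> m) = of_real s * zero_sum_profile (rcis \<rho> \<theta>) j) \<and>
        c = (cos \<theta>)\<^sup>2)"

definition S_bound :: "nat \<Rightarrow> real" where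
  "S_bound q = real q * (sqrt 2 - 1) / (real q * (2 - sqrt 2) - 1)"

definition c_plus :: real where
  "c_plus = (2 + sqrt 2) / 4"

end

theory Submission
  imports Defs "HOL-Number_Theory.Residues"
begin

text \<open>
  Testing \<open>\<sigma>\<^sub>m\<^sub>i\<^sub>n\<close> on diagonal matrices suffices, since for these the value of the measurement
  map at \<open>(k, l)\<close> does not depend on \<open>k\<close>. With \<open>\<xi> = \<zeta>\<^sup>\<tau>\<close>, a vector of the family satisfies
  \<open>\<phi>\<^sup>2 = r (2 + w cnj \<xi> + cnj w \<xi>)\<close> with \<open>r > 0\<close> and \<open>w = exp (2 \<i> \<theta>)\<close>, and on zero-sum diagonals of fixed
  parity the map is a multiple of the additive Fourier transform. Hence \<open>\<sigma>\<^sub>m\<^sub>i\<^sub>n\<close> is at most both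
  \<open>q \<bar>cos 2\<theta>\<bar> / (q - 2c)\<close> (even diagonals) and \<open>q \<bar>sin 2\<theta>\<bar> / (q - 2c)\<close> (odd diagonals). These two
  bounds coincide with \<open>S\<^sub>q\<close> at \<open>c = c\<^sub>+\<close>, and for \<open>cos 2\<theta> \<ge> 0\<close> their minimum drops at least
  linearly away from that point. The restriction on \<open>\<epsilon>\<close> excludes the second local maximum, at
  \<open>cos 2\<theta> = - sqrt 2 / 2\<close>.
\<close>

section \<open>Finite fields of characteristic 3 and their trace\<close>

lemma CHAR_eq_prime_of_CARD:
  assumes "CARD('a::{finite,field}) = p ^ h" "prime p"
  shows "CHAR('a) = p"
proof -
  have pr: "prime CHAR('a)"
    by (intro prime_CHAR_semidom finite_imp_CHAR_pos) auto
  moreover have "CHAR('a) dvd p ^ h"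
    using CHAR_dvd_CARD[where ?'a = 'a] assms by simp
  ultimately have "CHAR('a) dvd p"
    by (metis prime_dvd_power)
  then show ?thesis
    using pr assms(2) by (simp add: primes_dvd_imp_eq)
qed

text \<open>Multiplication by a nonzero \<open>x\<close> permutes the nonzero elements, so their
  product is unchanged when multiplied by \<open>x ^ (CARD('a) - 1)\<close>.\<close>

lemma power_CARD_eq_self:
  fixes x :: "'a::{finite,field}"
  shows "x ^ CARD('a) = x"
proof (cases "x = 0")
  case False
  have "bij_betw ((*) x) nonzero nonzero"
    using False by (intro bij_betwI[where g = "\<lambda>y. y / x"]) auto
  then have "(\<Prod>y\<in>nonzero. x * y) = \<Prod>nonzero"
    by (rule prod.reindex_bij_betw)
  then have "x ^ (CARD('a) - 1) = 1"
    by (simp add: prod.distrib card_Diff_singleton)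
  moreover have "CARD('a) = Suc (CARD('a) - 1)"
    by simp
  ultimately show ?thesis
    by (metis mult.right_neutral power_Suc)
qed (simp add: power_0_left)

lemma trace3_add:
  fixes x y :: "'a::{finite,field}"
  assumes "CHAR('a) = 3"
  shows "trace3 h (x + y) = trace3 h x + trace3 h y"
proof -
  have "(x + y) ^ 3 ^ i = x ^ 3 ^ i + y ^ 3 ^ i" for i
    by (rule freshmans_dream'[of _ i]) (simp_all add: assms)
  then show ?thesis
    by (simp add: trace3_def sum.distrib)
qed

text \<open>Cubing is additive and moves each conjugate to the next; the last one becomes
  \<open>x ^ 3 ^ h = x\<close> and closes the cycle.\<close>

lemma trace3_power3:
  fixes x :: "'a::{finite,field}"
  assumes "CHAR('a) = 3" "CARD('a) = 3 ^ h"
  shows "trace3 h x ^ 3 = trace3 h x"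
proof -
  have "trace3 h x ^ 3 = (\<Sum>i<h. (x ^ 3 ^ i) ^ 3)"
    unfolding trace3_def by (rule freshmans_dream_sum) (simp_all add: assms)
  also have "\<dots> = (\<Sum>i<h. x ^ 3 ^ Suc i)"
    by (simp flip: power_mult add: mult.commute)
  also have "\<dots> = (\<Sum>i<Suc h. x ^ 3 ^ i) - x"
    by (subst sum.lessThan_Suc_shift) simp
  also have "\<dots> = trace3 h x"
    using power_CARD_eq_self[of x] by (simp add: trace3_def assms)
  finally show ?thesis .
qed

text \<open>By the previous lemma the trace is a root of T^3 - T = T (T - 1) (T + 1), and the roots
  0, 1, -1 are integers.\<close>

lemma trace3_of_int:
  fixes x :: "'a::{finite,field}"
  assumes "CHAR('a) = 3" "CARD('a) = 3 ^ h"
  shows "\<exists>j. trace3 h x = of_int j"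
proof -
  let ?t = "trace3 h x"
  have "?t * ((?t - 1) * (?t + 1)) = 0"
    using trace3_power3[OF assms, of x] by (simp add: algebra_simps power3_eq_cube)
  then have "?t = of_int 0 \<or> ?t = of_int 1 \<or> ?t = of_int (-1)"
    by (auto simp: eq_neg_iff_add_eq_0)
  then show ?thesis
    by blast
qed

text \<open>The trace is a polynomial function of degree at most \<open>3 ^ (h - 1)\<close>, nonzero
  since its linear coefficient is 1. It therefore has too few roots to vanish on the whole
  field.\<close>

lemma trace3_nontrivial:
  assumes "CARD('a::{finite,field}) = 3 ^ h" "h \<ge> 1"
  shows "\<exists>x::'a. trace3 h x \<noteq> 0"
proof (rule ccontr)
  assume "\<not> ?thesis"
  then have z: "trace3 h x = 0" for x :: 'a
    by blast
  define p :: "'a poly" where "p = (\<Sum>i<h. Polynomial.monom 1 (3 ^ i))"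
  have "poly p x = trace3 h x" for x
    by (simp add: p_def trace3_def poly_sum poly_monom)
  then have "{x. poly p x = 0} = UNIV"
    using z by auto
  moreover have "Polynomial.coeff p 1 = 1"
  proof -
    have "Polynomial.coeff p 1 = (\<Sum>i<h. if i = 0 then 1 else 0)"
      unfolding p_def coeff_sum by (intro sum.cong) (auto simp: power_eq_1_iff)
    then show ?thesis
      using assms by simp
  qed
  then have "p \<noteq> 0"
    by auto
  moreover have "degree p \<le> 3 ^ (h - 1)"
    unfolding p_def
  proof (rule degree_sum_le)
    fix i assume "i \<in> {..<h}"
    then have "(3::nat) ^ i \<le> 3 ^ (h - 1)"
      by (intro power_increasing) auto
    then show "degree (Polynomial.monom 1 (3 ^ i) :: 'a poly) \<le> 3 ^ (h - 1)"
      using degree_monom_le order_trans by blast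
  qed auto
  ultimately have "CARD('a) \<le> 3 ^ (h - 1)"
    using card_poly_roots_bound[of p] by simp
  moreover have "(3::nat) ^ (h - 1) < 3 ^ h"
    using assms by (intro power_strict_increasing) auto
  ultimately show False
    using assms by simp
qed

section \<open>The additive character obtained from the trace\<close>

definition zeta :: complex where
  "zeta = cis (2 * pi / 3)"

lemma zeta_nonzero: "zeta \<noteq> 0"
  by (simp add: zeta_def)

lemma zeta_powi_eq_1_iff: "zeta powi j = 1 \<longleftrightarrow> 3 dvd j"
proof -
  have "zeta powi j = exp (\<i> * of_real (of_int j * (2 * pi / 3)))"
    unfolding zeta_def by (subst cis_power_int) (rule cis_conv_exp)
  also have "\<dots> = 1 \<longleftrightarrow> (\<exists>n::int. of_int j * (2 * pi / 3) = 2 * pi * of_int n)"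
    by (simp add: exp_eq_1 mult_ac)
  also have "\<dots> \<longleftrightarrow> (\<exists>n. j = 3 * n)"
  proof -
    have "of_int j * (2 * pi / 3) = 2 * pi * of_int n \<longleftrightarrow> j = 3 * n" for n
    proof -
      have "of_int j * (2 * pi / 3) = 2 * pi * of_int n \<longleftrightarrow> real_of_int j = of_int (3 * n)"
        by (auto simp: field_simps)
      then show ?thesis
        by (simp only: of_int_eq_iff)
    qed
    then show ?thesis
      by simp
  qed
  finally show ?thesis
    by (auto simp: dvd_def)
qed

text \<open>The choice of an integer lift is harmless: in characteristic 3 two lifts differ by a
  multiple of 3, which \<open>zeta\<close> does not see.\<close>

definition trace_char :: "nat \<Rightarrow> 'a::{finite,field} \<Rightarrow> complex" where
  "trace_char h x = zeta powi (SOME j. trace3 h x = of_int j)"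

lemma trace_char_eq:
  fixes x :: "'a::{finite,field}"
  assumes "CHAR('a) = 3" "trace3 h x = of_int j"
  shows "trace_char h x = zeta powi j"
proof -
  define k where "k = (SOME j. trace3 h x = of_int j)"
  have "trace3 h x = of_int k"
    unfolding k_def using assms(2) by (rule someI)
  then have "of_int (k - j) = (0 :: 'a)"
    using assms by simp
  then have "zeta powi (k - j) = 1"
    unfolding of_int_eq_0_iff_char_dvd zeta_powi_eq_1_iff by (simp add: assms)
  then show ?thesis
    by (simp add: trace_char_def k_def[symmetric] power_int_diff zeta_def)
qed

text \<open>This character serves as Fourier kernel for the squares of the vectors in the family; it
  is chosen independently of the character \<open>\<psi>\<close> in the representation.\<close>

lemma trace_char_nontrivial_character:
  assumes "CARD('a::{finite,field}) = 3 ^ h" "h \<ge> 1"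
  shows "nontrivial_additive_character (trace_char h :: 'a \<Rightarrow> complex)"
  unfolding nontrivial_additive_character_def
proof (intro conjI allI)
  have char: "CHAR('a) = 3"
    using assms by (intro CHAR_eq_prime_of_CARD) auto
  note tr = trace3_of_int[OF char assms(1)]
  show "trace_char h (x + y) = trace_char h x * trace_char h y" for x y :: 'a
  proof -
    obtain i j where ij: "trace3 h x = of_int i" "trace3 h y = of_int j"
      using tr by blast
    then have "trace3 h (x + y) = of_int (i + j)"
      by (simp add: trace3_add[OF char])
    then show ?thesis
      by (simp add: trace_char_eq[OF char] ij power_int_add zeta_nonzero del: of_int_add)
  qed
  show "cmod (trace_char h x) = 1" for x :: 'a
    by (simp add: trace_char_def norm_power_int zeta_def)
  obtain x :: 'a where x: "trace3 h x \<noteq> 0"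
    using trace3_nontrivial[OF assms] by blast
  obtain j where j: "trace3 h x = of_int j"
    using tr by blast
  then have "trace_char h x \<noteq> 1"
    using x by (simp add: trace_char_eq[OF char j] zeta_powi_eq_1_iff of_int_eq_0_iff_char_dvd char)
  then show "\<exists>x. trace_char h (x :: 'a) \<noteq> 1"
    by blast
qed

section \<open>Orthogonality and Parseval for additive characters\<close>

lemma character_0: "nontrivial_additive_character \<xi> \<Longrightarrow> \<xi> 0 = 1"
  unfolding nontrivial_additive_character_def
  by (metis add.right_neutral mult_cancel_left1 norm_zero zero_neq_one)

lemma character_minus: "nontrivial_additive_character \<xi> \<Longrightarrow> \<xi> (- x) = cnj (\<xi> x)"
proof -
  assume c: "nontrivial_additive_character \<xi>"
  then have "\<xi> x * \<xi> (- x) = 1"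
    unfolding nontrivial_additive_character_def by (metis add.right_inverse c character_0)
  moreover have "\<xi> x * cnj (\<xi> x) = 1"
    using c by (simp add: nontrivial_additive_character_def complex_norm_square[symmetric])
  ultimately show ?thesis
    by (metis mult_cancel_left mult_zero_left zero_neq_one)
qed

text \<open>A translation by \<open>y\<close> with \<open>\<xi> y \<noteq> 1\<close> preserves the
  sum and also multiplies it by \<open>\<xi> y\<close>.\<close>

lemma character_sum_0:
  fixes \<xi> :: "'a::{finite,field} \<Rightarrow> complex"
  assumes "nontrivial_additive_character \<xi>"
  shows "(\<Sum>x\<in>UNIV. \<xi> x) = 0"
proof -
  obtain y where y: "\<xi> y \<noteq> 1"
    using assms by (auto simp: nontrivial_additive_character_def)
  have "\<xi> y * (\<Sum>x\<in>UNIV. \<xi> x) = (\<Sum>x\<in>UNIV. \<xi> (y + x))"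
    using assms by (simp add: nontrivial_additive_character_def sum_distrib_left)
  also have "\<dots> = (\<Sum>x\<in>UNIV. \<xi> x)"
    by (rule sum.reindex_bij_betw, rule bij_betwI[where g = "\<lambda>x. x - y"]) auto
  finally show ?thesis
    using y by (metis mult_cancel_right1)
qed

lemma character_orthogonality:
  fixes \<xi> :: "'a::{finite,field} \<Rightarrow> complex"
  assumes "nontrivial_additive_character \<xi>"
  shows "(\<Sum>l\<in>UNIV. \<xi> (l * d)) = (if d = 0 then of_nat CARD('a) else 0)"
proof (cases "d = 0")
  case False
  have "bij_betw (\<lambda>l. l * d) UNIV UNIV"
    using False by (intro bij_betwI[where g = "\<lambda>l. l / d"]) auto
  then have "(\<Sum>l\<in>UNIV. \<xi> (l * d)) = (\<Sum>l\<in>UNIV. \<xi> l)"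
    by (rule sum.reindex_bij_betw)
  then show ?thesis
    using False character_sum_0[OF assms] by simp
qed (simp add: character_0[OF assms])

text \<open>After expanding the square and summing over \<open>l\<close> first, orthogonality leaves
  only the terms with \<open>m = n\<close>.\<close>

lemma character_parseval:
  fixes \<xi> :: "'a::{finite,field} \<Rightarrow> complex" and a :: "'a \<Rightarrow> complex"
  assumes "nontrivial_additive_character \<xi>"
  shows "(\<Sum>l\<in>UNIV. (cmod (\<Sum>m\<in>X. a m * \<xi> (l * m)))\<^sup>2) =
    of_nat CARD('a) * (\<Sum>m\<in>X. (cmod (a m))\<^sup>2)"
proof -
  have mult: "\<xi> (l * m) * cnj (\<xi> (l * n)) = \<xi> (l * (m - n))" for l m n
    using assms character_minus[OF assms, of "l * n"]
    by (metis diff_conv_add_uminus nontrivial_additive_character_def right_diff_distrib)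
  have "of_real (\<Sum>l\<in>UNIV. (cmod (\<Sum>m\<in>X. a m * \<xi> (l * m)))\<^sup>2)
     = (\<Sum>l\<in>UNIV. \<Sum>m\<in>X. \<Sum>n\<in>X. a m * cnj (a n) * \<xi> (l * (m - n)))"
    unfolding of_real_sum complex_norm_square cnj_sum sum_product
    by (simp add: mult[symmetric] mult_ac)
  also have "\<dots> = (\<Sum>m\<in>X. \<Sum>n\<in>X. \<Sum>l\<in>UNIV. a m * cnj (a n) * \<xi> (l * (m - n)))"
    by (subst sum.swap) (intro sum.cong refl sum.swap)
  also have "\<dots> = (\<Sum>m\<in>X. \<Sum>n\<in>X. if m = n then a m * cnj (a n) * of_nat CARD('a) else 0)"
    by (intro sum.cong refl) (simp add: sum_distrib_left[symmetric] character_orthogonality[OF assms])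
  also have "\<dots> = (\<Sum>m\<in>X. a m * cnj (a m) * of_nat CARD('a))"
    by (intro sum.cong refl) (simp add: sum.delta finite_subset[OF subset_UNIV])
  also have "\<dots> = of_real (of_nat CARD('a) * (\<Sum>m\<in>X. (cmod (a m))\<^sup>2))"
    by (simp add: complex_norm_square sum_distrib_left mult_ac del: of_real_power)
  finally show ?thesis
    by (simp only: of_real_eq_iff)
qed

section \<open>Upper bounds on the smallest singular value from diagonal matrices\<close>

lemma sigma_min_le:
  assumes "m \<in> nonzero" "n \<in> nonzero" "A m n \<noteq> 0"
  shows "sigma_min \<psi> \<phi> \<le>
    L2_set (\<lambda>g. cmod (meas_map \<psi> \<phi> A g)) (carrier affine_group) / frobenius_norm_nz A"
  unfolding sigma_min_def
proof (rule cINF_lower)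
  show "bdd_below ((\<lambda>A. L2_set (\<lambda>g. cmod (meas_map \<psi> \<phi> A g)) (carrier affine_group) /
          frobenius_norm_nz A) ` {A. \<exists>m\<in>nonzero. \<exists>n\<in>nonzero. A m n \<noteq> 0})"
    by (rule bdd_belowI[of _ 0]) (auto simp: frobenius_norm_nz_def)
qed (use assms in auto)

lemma mat_vec_diagonal:
  assumes "m \<in> nonzero"
  shows "mat_vec_nz (\<lambda>m n. if m = n then a m else 0) v m = a m * v m"
proof -
  have "mat_vec_nz (\<lambda>m n. if m = n then a m else 0) v m
      = (\<Sum>n\<in>nonzero. if m = n then a m * v m else 0)"
    unfolding mat_vec_nz_def by (rule sum.cong) auto
  then show ?thesis
    using assms by simp
qed

text \<open>The phase \<open>\<psi> (k * m)\<close> has modulus one and cancels against its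
  conjugate, so the translation part of \<open>g\<close> disappears.\<close>

lemma meas_map_diagonal:
  assumes "nontrivial_additive_character \<psi>"
  shows "meas_map \<psi> \<phi> (\<lambda>m n. if m = n then a m else 0) g =
    (\<Sum>m\<in>nonzero. a m * of_real ((cmod (\<phi> (snd g * m)))\<^sup>2))"
proof -
  let ?v = "affine_rep \<psi> g \<phi>"
  have "cmod (?v m) = cmod (\<phi> (snd g * m))" for m
    using assms by (simp add: affine_rep_def nontrivial_additive_character_def norm_mult)
  then have "mat_vec_nz (\<lambda>m n. if m = n then a m else 0) ?v m * cnj (?v m) =
      a m * of_real ((cmod (\<phi> (snd g * m)))\<^sup>2)" if "m \<in> nonzero" for m
    using complex_norm_square[of "?v m"] mat_vec_diagonal[OF that, of a ?v] by simp
  then show ?thesis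
    unfolding meas_map_def cinner_nz_def by (intro sum.cong) auto
qed

lemma frobenius_norm_diagonal:
  "frobenius_norm_nz (\<lambda>m n. if m = n then a m else 0) = L2_set (\<lambda>m. cmod (a m)) nonzero"
proof -
  have "(\<Sum>(m, n)\<in>nonzero \<times> nonzero. (cmod (if m = n then a m else 0))\<^sup>2)
      = (\<Sum>m\<in>nonzero. \<Sum>n\<in>nonzero. if m = n then (cmod (a m))\<^sup>2 else 0)"
    unfolding sum.cartesian_product[symmetric] by (intro sum.cong) auto
  also have "\<dots> = (\<Sum>m\<in>nonzero. (cmod (a m))\<^sup>2)"
    by (intro sum.cong) auto
  finally show ?thesis
    by (simp add: frobenius_norm_nz_def L2_set_def case_prod_unfold)
qed

text \<open>
  The parity of \<open>a\<close> merges the two conjugate exponentials in \<open>\<phi>\<^sup>2\<close> and the vanishing sum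
  removes its constant term, which leaves a Fourier transform of \<open>a\<close>.
\<close>

lemma sigma_min_le_parity:
  fixes \<xi> \<psi> :: "'a::{finite,field} \<Rightarrow> complex" and a \<phi> :: "'a \<Rightarrow> complex" and w \<eta> :: complex
  assumes \<xi>: "nontrivial_additive_character \<xi>" and \<psi>: "nontrivial_additive_character \<psi>"
    and \<phi>: "\<And>m. m \<in> nonzero \<Longrightarrow>
      of_real ((cmod (\<phi> m))\<^sup>2) = of_real r * (2 + w * \<xi> (- m) + cnj w * \<xi> m)"
    and r: "r \<ge> 0"
    and a: "\<And>m. a (- m) = \<eta> * a m" "(\<Sum>m\<in>nonzero. a m) = 0"
    and ne: "m0 \<in> nonzero" "a m0 \<noteq> 0"
  shows "sigma_min \<psi> \<phi> \<le> of_nat CARD('a) * r * cmod (\<eta> * w + cnj w)"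
proof -
  define A where "A = (\<lambda>m n. if m = n then a m else 0)"
  define k where "k = cmod (\<eta> * w + cnj w)"
  define E where "E l = (\<Sum>m\<in>nonzero. a m * \<xi> (l * m))" for l
  have neg: "(\<Sum>m\<in>nonzero. a m * \<xi> (- (l * m))) = \<eta> * E l" for l
  proof -
    have "bij_betw uminus (nonzero :: 'a set) nonzero"
      by (intro bij_betwI[where g = uminus]) auto
    then have "(\<Sum>m\<in>nonzero. a m * \<xi> (- (l * m))) = (\<Sum>m\<in>nonzero. a (- m) * \<xi> (- (l * - m)))"
      by (rule sum.reindex_bij_betw[symmetric])
    then show ?thesis
      by (simp add: a E_def sum_distrib_left mult_ac)
  qed
  have M: "cmod (meas_map \<psi> \<phi> A (b, l)) = r * k * cmod (E l)" if "l \<noteq> 0" for b l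
  proof -
    have "meas_map \<psi> \<phi> A (b, l) =
        (\<Sum>m\<in>nonzero. of_real r * (2 * a m + w * (a m * \<xi> (- (l * m))) + cnj w * (a m * \<xi> (l * m))))"
      unfolding A_def meas_map_diagonal[OF \<psi>] using that
      by (intro sum.cong) (auto simp: \<phi> algebra_simps simp del: of_real_power)
    also have "\<dots> = of_real r * (2 * (\<Sum>m\<in>nonzero. a m) +
        w * (\<Sum>m\<in>nonzero. a m * \<xi> (- (l * m))) + cnj w * E l)"
      by (simp add: sum.distrib sum_distrib_left E_def distrib_left)
    also have "\<dots> = of_real r * ((\<eta> * w + cnj w) * E l)"
      unfolding neg a by (simp add: algebra_simps)
    finally show ?thesis
      using r by (simp add: norm_mult k_def)
  qed
  have k0: "k \<ge> 0"
    by (simp add: k_def)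
  define F where "F = L2_set (\<lambda>m. cmod (a m)) (nonzero :: 'a set)"
  have F2: "F\<^sup>2 = (\<Sum>m\<in>nonzero. (cmod (a m))\<^sup>2)"
    by (simp add: F_def L2_set_def sum_nonneg)
  have "F > 0"
  proof -
    have "0 < (\<Sum>m\<in>nonzero. (cmod (a m))\<^sup>2)"
      by (rule sum_pos2[OF _ ne(1)]) (use ne in auto)
    then show ?thesis
      by (simp add: F_def L2_set_def)
  qed
  \<comment> \<open>The group only provides nonzero \<open>l\<close>; since the zero frequency
    vanishes, the sum can be extended to the whole field, where Parseval applies.\<close>
  have E0: "E 0 = 0"
    by (simp add: E_def character_0[OF \<xi>] a)
  \<comment> \<open>One factor \<open>CARD('a)\<close> comes from the free translation coordinate
    and a second one from Parseval, hence a single factor after the square root.\<close>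
  have "(\<Sum>g\<in>UNIV \<times> nonzero. (cmod (meas_map \<psi> \<phi> A g))\<^sup>2) =
      (\<Sum>(b::'a,l)\<in>UNIV \<times> nonzero. (r * k * cmod (E l))\<^sup>2)"
    by (intro sum.cong refl) (use M in force)
  also have "\<dots> = of_nat CARD('a) * (r * k)\<^sup>2 * (\<Sum>l\<in>nonzero. (cmod (E l))\<^sup>2)"
    by (simp add: sum.cartesian_product[symmetric] sum_distrib_left power_mult_distrib mult_ac)
  also have "(\<Sum>l\<in>nonzero. (cmod (E l))\<^sup>2) = (\<Sum>l\<in>UNIV. (cmod (E l))\<^sup>2)"
    by (rule sum.mono_neutral_left) (auto simp: E0)
  also have "\<dots> = of_nat CARD('a) * F\<^sup>2"
    unfolding E_def F2 by (rule character_parseval[OF \<xi>])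
  finally have "(\<Sum>g\<in>UNIV \<times> nonzero. (cmod (meas_map \<psi> \<phi> A g))\<^sup>2) =
      (of_nat CARD('a) * r * k * F)\<^sup>2"
    by (simp add: power2_eq_square mult_ac)
  then have "L2_set (\<lambda>g. cmod (meas_map \<psi> \<phi> A g)) (carrier affine_group) = of_nat CARD('a) * r * k * F"
    using r k0 \<open>F > 0\<close> by (simp add: L2_set_def affine_group_def)
  moreover have "frobenius_norm_nz A = F"
    unfolding A_def F_def by (rule frobenius_norm_diagonal)
  moreover have "sigma_min \<psi> \<phi> \<le>
      L2_set (\<lambda>g. cmod (meas_map \<psi> \<phi> A g)) (carrier affine_group) / frobenius_norm_nz A"
    using ne by (intro sigma_min_le[of m0 m0]) (auto simp: A_def)
  ultimately show ?thesis
    using \<open>F > 0\<close> by (simp add: k_def)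
qed

section \<open>The real optimization problem\<close>

text \<open>Here \<open>x\<close> and \<open>s\<close> stand for cos 2\<theta> and |sin 2\<theta>|,
  \<open>N\<close> for q - 1 and \<open>t\<close> for sqrt 2 / 2. For \<open>x < 0\<close> the bound
  on \<open>\<epsilon>\<close> gives a contradiction; for \<open>0 \<le> x \<le> t\<close> the even
  bound controls the distance to \<open>t\<close>, and for \<open>x > t\<close> the odd one
  does.\<close>

lemma near_optimal_parameter:
  fixes N x s \<epsilon> t :: real
  assumes t: "t > 0" "2 * t\<^sup>2 = 1" and N: "N \<ge> 3" and x: "x\<^sup>2 + s\<^sup>2 = 1" "s \<ge> 0"
    and eps: "0 \<le> \<epsilon>" "\<epsilon> < t / N"
    and le_x: "(1 - \<epsilon>) * (t / (N - t)) \<le> \<bar>x\<bar> / (N - x)"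
    and le_s: "(1 - \<epsilon>) * (t / (N - t)) \<le> s / (N - x)"
  shows "\<bar>x - t\<bar> \<le> 2 * t * \<epsilon>"
proof -
  have t1: "t \<le> 1"
    using t by (intro power2_le_imp_le[of t 1]) auto
  have x1: "\<bar>x\<bar> \<le> 1"
    using x by (intro power2_le_imp_le[of "\<bar>x\<bar>" 1]) (auto, smt (verit) zero_le_power2)
  have Nt: "N - t > 0" and Nx: "N - x > 0"
    using N t1 x1 by auto
  have mono: "(1 - \<epsilon>) * t * (N - x) \<le> z * (N - t)" if "(1 - \<epsilon>) * (t / (N - t)) \<le> z / (N - x)" for z
    using that Nt Nx by (simp add: field_simps)
  note ix = mono[OF le_x] and sN = mono[OF le_s]
  \<comment> \<open>The circle lies below its tangent at \<open>(t, t)\<close>, which gives the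
    linear bound \<open>s \<le> 2 * t - x\<close>.\<close>
  have "(x + s)\<^sup>2 \<le> 2 * (x\<^sup>2 + s\<^sup>2)"
    using sum_squares_bound[of x s] by (simp add: power2_sum)
  then have "(x + s)\<^sup>2 \<le> (2 * t)\<^sup>2"
    using t x by (simp add: power_mult_distrib)
  then have st: "s \<le> 2 * t - x"
    using t by (smt (verit) power2_le_imp_le)
  have eN: "\<epsilon> * N \<le> t" "\<epsilon> < 1"
  proof -
    show "\<epsilon> * N \<le> t"
      using eps N by (simp add: field_simps)
    show "\<epsilon> < 1"
      using eps N t1 by (smt (verit) divide_le_eq_1)
  qed
  consider "x < 0" | "0 \<le> x" "x \<le> t" | "t < x"
    by linarith
  then show ?thesis
  proof cases
    case 1
    \<comment> \<open>The right-hand side is the common value of both ratios at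
      \<open>x = -t\<close>, the maximum of their minimum over negative \<open>x\<close>: the even
      ratio stays below it for \<open>-x \<le> t\<close>, the odd one beyond.\<close>
    have "(1 - \<epsilon>) * (t / (N - t)) \<le> t / (N + t)"
    proof (cases "-x \<le> t")
      case True
      have "\<bar>x\<bar> / (N - x) \<le> t / (N + t)"
      proof -
        have "- x * (N + t) \<le> t * (N - x)"
          using mult_right_mono[OF True, of N] N by (simp add: algebra_simps)
        then show ?thesis
          using 1 Nx N t by (simp add: divide_le_eq le_divide_eq field_simps)
      qed
      then show ?thesis
        using le_x by linarith
    next
      case False
      have "t\<^sup>2 \<le> (-x)\<^sup>2"
        using False t by (intro power_mono) auto
      then have "s\<^sup>2 \<le> t\<^sup>2"
        using x t unfolding power2_minus by linarith
      then have "s \<le> t"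
        using t by (intro power2_le_imp_le[of s t]) auto
      then have "s / (N - x) \<le> t / (N + t)"
        using False t N by (intro frac_le) auto
      then show ?thesis
        using le_s by linarith
    qed
    then have "(1 - \<epsilon>) * t * (N + t) \<le> t * (N - t)"
      using Nt N t by (simp add: field_simps)
    then have "(1 - \<epsilon>) * (N + t) \<le> N - t"
      using t by (simp add: mult.assoc mult.left_commute)
    \<comment> \<open>This contradicts \<open>\<epsilon> * N \<le> t\<close> together with
      \<open>\<epsilon> * t < t\<close>.\<close>
    then have "2 * t \<le> \<epsilon> * N + \<epsilon> * t"
      by (simp add: algebra_simps)
    moreover have "\<epsilon> * t < 1 * t"
      using eN t by (intro mult_strict_right_mono) auto
    ultimately show ?thesis
      using eN by linarith
  next
    case 2
    define d where "d = t - x"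
    have "d * N \<le> \<epsilon> * t * (N - t + d)"
      using ix 2 by (simp add: d_def algebra_simps)
    \<comment> \<open>Nonnegativity of \<open>x\<close> means \<open>d \<le> t\<close>.\<close>
    also have "\<dots> \<le> \<epsilon> * t * N"
      using 2 eps t by (intro mult_left_mono) (auto simp: d_def)
    finally have "d \<le> \<epsilon> * t"
      using N by (metis less_le_trans mult_le_cancel_right_pos mult.assoc zero_less_numeral)
    also have "\<dots> \<le> 2 * t * \<epsilon>"
      using eps t by simp
    finally show ?thesis
      using 2 by (simp add: d_def)
  next
    case 3
    define d where "d = x - t"
    have "(1 - \<epsilon>) * t * (N - x) \<le> (2 * t - x) * (N - t)"
      using sN st Nt by (smt (verit) mult_right_mono)
    then have "d * (N - 2 * t) \<le> \<epsilon> * t * (N - t - d)"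
      by (simp add: d_def algebra_simps)
    \<comment> \<open>Since \<open>N \<ge> 3\<close> and \<open>t \<le> 1\<close>, one has
      \<open>N - t \<le> 2 * (N - 2 * t)\<close>. The factor 2 in the conclusion arises
      here.\<close>
    also have "\<dots> \<le> \<epsilon> * t * (2 * (N - 2 * t))"
      using 3 eps t N t1 by (intro mult_left_mono) (auto simp: d_def)
    finally have "d * (N - 2 * t) \<le> (2 * t * \<epsilon>) * (N - 2 * t)"
      by (simp add: mult_ac)
    then have "d \<le> 2 * t * \<epsilon>"
      using N t1 by (subst (asm) mult_le_cancel_right_pos) auto
    then show ?thesis
      using 3 by (simp add: d_def)
  qed
qed

section \<open>The form of S_q at the optimum and the conclusion\<close>

text \<open>Expanding the right-hand fraction by \<open>2 - sqrt 2\<close> gives the definition.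
  This form shows S_q as the value of both diagonal bounds at cos 2\<theta> = sqrt 2 / 2.\<close>

lemma S_bound_eq:
  assumes "q \<ge> 9"
  shows "S_bound q = real q * (sqrt 2 / 2 / (real q - 1 - sqrt 2 / 2))"
proof -
  have "sqrt 2 \<le> 3 / 2"
    by (rule real_le_lsqrt) (auto simp: power2_eq_square)
  moreover from this have "9 * (1 / 2) \<le> real q * (2 - sqrt 2)"
    using assms by (intro mult_mono) auto
  ultimately have "real q * (2 - sqrt 2) - 1 \<noteq> 0" "real q - 1 - sqrt 2 / 2 \<noteq> 0"
    using assms by auto
  then have "(sqrt 2 - 1) / (real q * (2 - sqrt 2) - 1) = sqrt 2 / 2 / (real q - 1 - sqrt 2 / 2)"
    by (subst frac_eq_eq) (auto simp: algebra_simps diff_divide_distrib)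
  then show ?thesis
    unfolding S_bound_def by (metis times_divide_eq_right)
qed

theorem corollary6p19:
  fixes \<psi> :: "'a::{finite,field} \<Rightarrow> complex" and \<phi> :: "'a \<Rightarrow> real"
    and h q :: nat and c \<epsilon> :: real
  assumes "h \<ge> 2" and "q = 3 ^ h" and "CARD('a) = q"
    and "nontrivial_additive_character \<psi>"
    and "\<phi> \<in> zero_sum_family h"
    and "has_zero_sum_parameter h \<phi> c"
    and "sigma_min \<psi> (\<lambda>m. complex_of_real (\<phi> m)) \<ge> (1 - \<epsilon>) * S_bound q"
    and "0 \<le> \<epsilon>" and "\<epsilon> < sqrt 2 / (2 * (real q - 1))"
  shows "\<bar>c - c_plus\<bar> \<le> \<epsilon> / sqrt 2"
proof -
  have q: "CARD('a) = 3 ^ h" "h \<ge> 1" and q9: "q \<ge> 9"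
    using assms power_increasing[of 2 h "3::nat"] by auto
  have char: "CHAR('a) = 3"
    by (rule CHAR_eq_prime_of_CARD[OF q(1)]) simp
  have three: "(3 :: 'a) = 0"
    using of_nat_CHAR[where ?'a = 'a] by (simp add: char)
  define \<xi> :: "'a \<Rightarrow> complex" where "\<xi> = trace_char h"
  have \<xi>: "nontrivial_additive_character \<xi>"
    unfolding \<xi>_def by (rule trace_char_nontrivial_character[OF q])
  obtain s \<rho> \<theta> where s: "s > 0" "\<rho> > 0" and c: "c = (cos \<theta>)\<^sup>2"
    and prof: "\<And>m j. m \<in> nonzero \<Longrightarrow> trace3 h m = of_int j \<Longrightarrow>
      complex_of_real (\<phi> m) = of_real s * zero_sum_profile (rcis \<rho> \<theta>) j"
    using assms(6) unfolding has_zero_sum_parameter_def by blast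
  define r where "r = (s * \<rho>)\<^sup>2"
  define w where "w = cis (2 * \<theta>)"
  define N where "N = real q - 1"
  define x where "x = cos (2 * \<theta>)"
  define t where "t = sqrt 2 / 2"
  have \<phi>: "complex_of_real ((\<phi> m)\<^sup>2) = of_real r * (2 + w * \<xi> (- m) + cnj w * \<xi> m)"
    if m: "m \<in> nonzero" for m
  proof -
    obtain j where j: "trace3 h m = of_int j"
      using trace3_of_int[OF char q(1)] by blast
    have cm: "\<xi> m * cnj (\<xi> m) = 1"
      using \<xi> by (simp add: nontrivial_additive_character_def complex_norm_square[symmetric])
    have \<xi>m: "\<xi> m = zeta powi j"
      unfolding \<xi>_def by (rule trace_char_eq[OF char j])
    have "cnj (\<xi> m) = zeta powi (- j)"
      by (simp add: \<xi>m zeta_def cis_power_int cis_cnj)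
    then have f: "complex_of_real (\<phi> m) =
        of_real (s * \<rho>) * (cis \<theta> * \<xi> m + cis (- \<theta>) * cnj (\<xi> m))"
      using prof[OF m j] by (simp add: zero_sum_profile_def zeta_def \<xi>m rcis_def cis_cnj algebra_simps)
    \<comment> \<open>In characteristic 3 doubling is negation, so the square of
      \<open>\<xi> m\<close> is its conjugate; the squared profile thus involves only the
      frequencies of the profile and a constant.\<close>
    have "m + m = - m"
      using arg_cong[OF three, of "\<lambda>x. x * m"] by (simp add: eq_neg_iff_add_eq_0 algebra_simps)
    then have sq: "\<xi> m * \<xi> m = cnj (\<xi> m)"
      using \<xi> character_minus[OF \<xi>, of m] by (metis nontrivial_additive_character_def)
    have sq': "cnj (\<xi> m) * cnj (\<xi> m) = \<xi> m"
      using arg_cong[OF sq, of cnj] by simp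
    have "complex_of_real ((\<phi> m)\<^sup>2) = of_real r * (cis \<theta> * \<xi> m + cis (- \<theta>) * cnj (\<xi> m))\<^sup>2"
      by (simp add: f r_def power_mult_distrib)
    also have "(cis \<theta> * \<xi> m + cis (- \<theta>) * cnj (\<xi> m))\<^sup>2
        = (cis \<theta> * cis \<theta>) * (\<xi> m * \<xi> m) + (cis (- \<theta>) * cis (- \<theta>)) * (cnj (\<xi> m) * cnj (\<xi> m))
          + 2 * (cis \<theta> * cis (- \<theta>)) * (\<xi> m * cnj (\<xi> m))"
      by (simp add: power2_eq_square algebra_simps)
    also have "\<dots> = 2 + w * \<xi> (- m) + cnj w * \<xi> m"
      by (simp add: sq sq' cm cis_mult w_def cis_cnj character_minus[OF \<xi>])
    finally show ?thesis .
  qed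
  \<comment> \<open>The unit norm determines \<open>r\<close>: the constant 2 contributes
    \<open>2 * N\<close>, and each character sum over the nonzero elements is -1.\<close>
  have norm: "r * (2 * (N - x)) = 1"
  proof -
    have L2: "(\<Sum>m\<in>nonzero. (\<phi> m)\<^sup>2) = 1"
      using assms(5) by (simp add: zero_sum_family_def L2_set_def)
    have \<xi>1: "(\<Sum>m\<in>nonzero. \<xi> m) = -1"
      using character_sum_0[OF \<xi>] by (simp add: sum_diff1 character_0[OF \<xi>])
    have \<xi>2: "(\<Sum>m\<in>nonzero. \<xi> (- m)) = -1"
      using arg_cong[OF \<xi>1, of cnj] by (simp add: character_minus[OF \<xi>])
    have "complex_of_real 1 = (\<Sum>m\<in>nonzero. of_real ((\<phi> m)\<^sup>2))"
      by (subst of_real_sum[symmetric]) (simp only: L2)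
    also have "\<dots> = of_real r * (2 * of_nat (CARD('a) - 1) +
        w * (\<Sum>m\<in>nonzero. \<xi> (- m)) + cnj w * (\<Sum>m\<in>nonzero. \<xi> m))"
      by (simp add: \<phi> sum.distrib sum_distrib_left[symmetric] card_Diff_singleton mult.commute del: of_real_power)
    also have "\<dots> = of_real r * (2 * of_real N - (w + cnj w))"
      using q9 assms(3) by (simp add: \<xi>1 \<xi>2 N_def of_nat_diff algebra_simps)
    also have "\<dots> = of_real (r * (2 * (N - x)))"
      unfolding complex_add_cnj by (simp add: w_def x_def algebra_simps)
    finally show ?thesis
      by (metis of_real_eq_iff)
  qed
  have r: "r \<ge> 0"
    by (simp add: r_def)
  have N8: "N \<ge> 8"
    using q9 by (simp add: N_def)
  have x1: "N - x > 0"
    using cos_le_one[of "2 * \<theta>"] N8 unfolding x_def by linarith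
  have scale: "real q * r * (2 * z) = real q * (z / (N - x))" for z
  proof -
    have r_eq: "r = 1 / (2 * (N - x))"
      using norm x1 by (simp add: eq_divide_eq)
    show ?thesis
      unfolding r_eq using x1 by (simp add: divide_simps)
  qed
  have \<phi>': "complex_of_real ((cmod (complex_of_real (\<phi> m)))\<^sup>2) =
      of_real r * (2 + w * \<xi> (- m) + cnj w * \<xi> m)"
    if "m \<in> nonzero" for m
    using \<phi>[OF that] by simp
  note bound = sigma_min_le_parity[OF \<xi> assms(4) \<phi>' r]
  have neq: "g \<noteq> - g" if "g \<noteq> 0" for g :: 'a
  proof
    assume "g = - g"
    then have "g + g = 0"
      by (metis add.right_inverse)
    moreover have "g + g + g = 0"
      using arg_cong[OF three, of "\<lambda>x. x * g"] by (simp add: algebra_simps)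
    ultimately show False
      using that by simp
  qed
  have neg_eq: "- m = y \<longleftrightarrow> m = - y" for m y :: 'a
    by (metis minus_minus)
  have odd: "sigma_min \<psi> (\<lambda>m. complex_of_real (\<phi> m)) \<le> real q * (\<bar>sin (2 * \<theta>)\<bar> / (N - x))"
  proof -
    \<comment> \<open>The simplest odd diagonal, supported on 1 and -1, which differ because the
      characteristic is 3.\<close>
    define a :: "'a \<Rightarrow> complex" where "a m = of_bool (m = 1) - of_bool (m = -1)" for m
    have "(\<Sum>m\<in>nonzero. a m) = 0"
      by (simp add: a_def sum_subtractf sum_of_bool_eq)
    moreover have "a (- m) = -1 * a m" for m
      unfolding a_def neg_eq by simp
    moreover have "a 1 \<noteq> 0"
      using neq[of 1] by (simp add: a_def)
    ultimately have "sigma_min \<psi> (\<lambda>m. complex_of_real (\<phi> m)) \<le> CARD('a) * r * cmod (- 1 * w + cnj w)"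
      by (intro bound[of a "-1" 1]) auto
    also have "- 1 * w + cnj w = - (w - cnj w)"
      by simp
    also have "cmod \<dots> = 2 * \<bar>sin (2 * \<theta>)\<bar>"
      unfolding norm_minus_cancel complex_diff_cnj by (simp add: w_def norm_mult)
    finally show ?thesis
      by (simp only: scale assms(3))
  qed
  have even: "sigma_min \<psi> (\<lambda>m. complex_of_real (\<phi> m)) \<le> real q * (\<bar>x\<bar> / (N - x))"
  proof -
    \<comment> \<open>A nonzero even diagonal of sum zero needs two pairs of opposite elements, so
      the field must have more than three elements; here \<open>h \<ge> 2\<close> enters through
      \<open>q \<ge> 9\<close>.\<close>
    have "\<exists>g. g \<notin> {0, 1, -1 :: 'a}"
    proof (rule ccontr)
      assume "\<not> ?thesis"
      then have "UNIV = {0, 1, -1 :: 'a}"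
        by blast
      moreover have "card {0, 1, -1 :: 'a} \<le> 3"
        by (simp add: card_insert_if)
      ultimately have "CARD('a) \<le> 3"
        by simp
      then show False
        using q9 assms(3) by simp
    qed
    then obtain g :: 'a where g: "g \<noteq> 0" "g \<noteq> 1" "g \<noteq> -1"
      by blast
    define a :: "'a \<Rightarrow> complex" where "a m = of_bool (m \<in> {1, -1}) - of_bool (m \<in> {g, -g})" for m
    have "(\<Sum>m\<in>nonzero. a m) = 0"
    proof -
      have i: "(\<Sum>m\<in>nonzero. of_bool (m \<in> {y, -y}) :: complex) = 2" if "y \<noteq> 0" for y :: 'a
      proof -
        have "(nonzero \<inter> {m. m \<in> {y, -y}}) = {y, -y}"
          using that by auto
        then show ?thesis
          using neq[OF that] by (simp only: sum_of_bool_eq finite card_2_iff) simp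
      qed
      show ?thesis
        using i[of 1] i[of g] g by (simp only: a_def sum_subtractf) simp
    qed
    moreover have "a (- m) = 1 * a m" for m
      unfolding a_def insert_iff empty_iff neg_eq minus_minus by (simp add: disj_commute)
    moreover have "a 1 \<noteq> 0"
      using g neg_eq[of g 1] by (auto simp: a_def)
    ultimately have "sigma_min \<psi> (\<lambda>m. complex_of_real (\<phi> m)) \<le> CARD('a) * r * cmod (1 * w + cnj w)"
      by (intro bound[of a 1 1]) auto
    also have "cmod (1 * w + cnj w) = 2 * \<bar>x\<bar>"
      unfolding mult_1 complex_add_cnj by (simp add: w_def x_def norm_mult)
    finally show ?thesis
      by (simp only: scale assms(3))
  qed
  have lower: "real q * ((1 - \<epsilon>) * (t / (N - t))) \<le> sigma_min \<psi> (\<lambda>m. complex_of_real (\<phi> m))"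
    using assms(7) unfolding S_bound_eq[OF q9] N_def t_def by (simp only: mult.left_commute)
  have "\<bar>x - t\<bar> \<le> 2 * t * \<epsilon>"
  proof (rule near_optimal_parameter)
    show "x\<^sup>2 + \<bar>sin (2 * \<theta>)\<bar>\<^sup>2 = 1"
      by (simp add: x_def)
    show "(1 - \<epsilon>) * (t / (N - t)) \<le> \<bar>x\<bar> / (N - x)"
      using order_trans[OF lower even] q9 by (simp add: mult_le_cancel_left_pos del: times_divide_eq_right)
    show "(1 - \<epsilon>) * (t / (N - t)) \<le> \<bar>sin (2 * \<theta>)\<bar> / (N - x)"
      using order_trans[OF lower odd] q9 by (simp add: mult_le_cancel_left_pos del: times_divide_eq_right)
  qed (use N8 assms(8,9) in \<open>auto simp: t_def N_def power_divide\<close>)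
  \<comment> \<open>By \<open>x = 2 * c - 1\<close> and \<open>t = 2 * c_plus - 1\<close>, halving
    the bound \<open>2 * t * \<epsilon>\<close> leaves \<open>t * \<epsilon>\<close>, that is
    \<open>\<epsilon> / sqrt 2\<close>.\<close>
  moreover have "x - t = 2 * (c - c_plus)"
    unfolding x_def t_def c c_plus_def cos_double_cos by (simp add: field_simps)
  moreover have "t = 1 / sqrt 2"
    by (simp add: t_def field_simps)
  ultimately show ?thesis
    by (simp add: abs_mult)
qed

end
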